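(* Let $G=(V,E)$ be a directed graph with $V=[p]$ whose edge set contains all self-loops $i\to i$, $i\in[p]$. If $\mathcal{M}_{G,C}$ is generically identifiable for a diagonal matrix $C\in\mathrm{PD}_p$, then $$|E|\le \frac{p(p+1)}{2}-\#\big\{\{i,j\}: i,j\in V \text{ with no trek between them}\big\}.$$
   Context: $[p]=\{1,\dots,p\}$, and $\mathrm{PD}_p$ is the cone of real symmetric positive definite $p\times p$ matrices. All directed graphs are assumed to contain all self-loops, and $|E|$ counts the self-loops. A trek is a sequence of edges of the form $l_m\leftarrow l_{m-1}\leftarrow\dots\leftarrow l_1\leftarrow t\rightarrow r_1\rightarrow\dots\rightarrow r_{n-1}\rightarrow r_n$ (a trek between its two end nodes); one or both sides may be trivial, so directed paths and single nodes are also treks. $\mathbb{R}^E$ is the space of real $p\times p$ matrices $M=(m_{ij})$ with $m_{ji}=0$ whenever $i\to j\notin E$; $\mathrm{Stab}(E)\subseteq\mathbb{R}^E$ is the subset of stable matrices (all eigenvalues have negative real part). For $C\in\mathrm{PD}_p$, $\mathcal{M}_{G,C}=\{\Sigma\in\mathrm{PD}_p: M\Sigma+\Sigma M^\top=-C \text{ for some } M\in\mathbb{R}^E\}$. The map $\phi_{G,C}:\mathrm{Stab}(E)\to\mathrm{PD}_p$ sends $M$ to the unique $\Sigma$ solving $M\Sigma+\Sigma M^\top+C=0$. The fiber of $M_0\in\mathrm{Stab}(E)$ is $\mathcal{F}_{G,C}(M_0)=\{M\in\mathrm{Stab}(E):\phi_{G,C}(M)=\phi_{G,C}(M_0)\}$.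 The model $\mathcal{M}_{G,C}$ is generically identifiable if the set of $M_0\in\mathrm{Stab}(E)$ with $\mathcal{F}_{G,C}(M_0)\neq\{M_0\}$ is a Lebesgue null set in $\mathbb{R}^E$. *)

theory Defs
  imports "HOL-Analysis.Analysis"
begin

definition PD :: "(real ^ 'n ^ 'n) set" where
  "PD = {A. transpose A = A \<and> (\<forall>x. x \<noteq> 0 \<longrightarrow> x \<bullet> (A *v x) > 0)}"

definition diagonal_matrix :: "'a::zero ^ 'n ^ 'n \<Rightarrow> bool" where
  "diagonal_matrix A \<longleftrightarrow> (\<forall>i j. i \<noteq> j \<longrightarrow> A $ i $ j = 0)"

definition complex_eigenvalue :: "real ^ 'n ^ 'n \<Rightarrow> complex \<Rightarrow> bool" where
  "complex_eigenvalue M z \<longleftrightarrow> (\<exists>v. v \<noteq> 0 \<and> map_matrix complex_of_real M *v v = z *s v)"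

definition stable_matrix :: "real ^ 'n ^ 'n \<Rightarrow> bool" where
  "stable_matrix M \<longleftrightarrow> (\<forall>z. complex_eigenvalue M z \<longrightarrow> Re z < 0)"

(* A directed graph on the vertex type 'n is given by its edge set E; a pair (i, j) in E is the
   edge i \<rightarrow> j. Note the transposed index convention: the edge i \<rightarrow> j corresponds to
   the matrix entry in row j and column i. *)

definition edge_matrices :: "('n \<times> 'n) set \<Rightarrow> (real ^ 'n ^ 'n) set" where
  "edge_matrices E = {M. \<forall>i j. (i, j) \<notin> E \<longrightarrow> M $ j $ i = 0}"

definition Stab :: "('n \<times> 'n) set \<Rightarrow> (real ^ 'n ^ 'n) set" where
  "Stab E = {M \<in> edge_matrices E. stable_matrix M}"

(* For stable M and positive definite C the Lyapunov equation has exactly one solution, and this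
   solution is positive definite. For other M or C the value is irrelevant. *)
definition lyapunov_map :: "real ^ 'n ^ 'n \<Rightarrow> real ^ 'n ^ 'n \<Rightarrow> real ^ 'n ^ 'n" where
  "lyapunov_map C M = (THE S. S \<in> PD \<and> M ** S + S ** transpose M + C = 0)"

definition lyapunov_fiber ::
  "('n \<times> 'n) set \<Rightarrow> real ^ 'n ^ 'n \<Rightarrow> real ^ 'n ^ 'n \<Rightarrow> (real ^ 'n ^ 'n) set" where
  "lyapunov_fiber E C M0 = {M \<in> Stab E. lyapunov_map C M = lyapunov_map C M0}"

(* Lebesgue measure on the linear space edge_matrices E, which has dimension card E, is the
   completed product measure under the coordinate isomorphism onto the functions on E. *)

definition edge_coords :: "('n \<times> 'n) set \<Rightarrow> real ^ 'n ^ 'n \<Rightarrow> 'n \<times> 'n \<Rightarrow> real" where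
  "edge_coords E M = (\<lambda>(i, j)\<in>E. M $ j $ i)"

definition lebesgue_null_in_edge_matrices ::
  "('n \<times> 'n) set \<Rightarrow> (real ^ 'n ^ 'n) set \<Rightarrow> bool" where
  "lebesgue_null_in_edge_matrices E X \<longleftrightarrow>
     edge_coords E ` X \<in> null_sets (completion (PiM E (\<lambda>_. lborel)))"

definition generically_identifiable :: "('n \<times> 'n) set \<Rightarrow> real ^ 'n ^ 'n \<Rightarrow> bool" where
  "generically_identifiable E C \<longleftrightarrow>
     lebesgue_null_in_edge_matrices E {M0 \<in> Stab E. lyapunov_fiber E C M0 \<noteq> {M0}}"

(* A walk is given by its nonempty list of vertices; a single vertex is the trivial walk. *)
definition directed_walk :: "('n \<times> 'n) set \<Rightarrow> 'n list \<Rightarrow> bool" where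
  "directed_walk E xs \<longleftrightarrow> xs \<noteq> [] \<and> successively (\<lambda>i j. (i, j) \<in> E) xs"

(* A trek is given by its left side [t, l_1, ..., l_m] and right side [t, r_1, ..., r_n], both
   starting in the top node t. *)
definition trek :: "('n \<times> 'n) set \<Rightarrow> 'n list \<Rightarrow> 'n list \<Rightarrow> bool" where
  "trek E ls rs \<longleftrightarrow> directed_walk E ls \<and> directed_walk E rs \<and> hd ls = hd rs"

definition trek_between :: "('n \<times> 'n) set \<Rightarrow> 'n \<Rightarrow> 'n \<Rightarrow> bool" where
  "trek_between E i j \<longleftrightarrow> (\<exists>ls rs. trek E ls rs \<and> last ls = i \<and> last rs = j)"

definition no_trek_pairs :: "('n \<times> 'n) set \<Rightarrow> 'n set set" where
  "no_trek_pairs E = {{i, j} | i j. \<not> trek_between E i j}"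

end

(* Let S be the solution of M S + S M^T = -C. As C is diagonal, S vanishes at all pairs without a
   trek between them, and so does D S + S D^T for every D in R^E. If |E| exceeded the dimension of
   the space of symmetric matrices with these zeros, then D S + S D^T = 0 for some nonzero D in R^E,
   and M + D, which is again stable because S and C are positive definite, would lie in the fiber
   of M. The fiber would thus be nontrivial for all M in a box of positive measure near -I.
   Instead of the integral formula for S, the properties of the Lyapunov equation are obtained from
   an extremal generalized eigenvector X x = l P x, for which
   x^T (M X + X M^T) x = l x^T (M P + P M^T) x. *)
theory Submission
  imports Defs
begin

section \<open>Quadratic forms and the Lyapunov operator\<close>

definition lyapunov_op :: "real ^ 'n ^ 'n \<Rightarrow> real ^ 'n ^ 'n \<Rightarrow> real ^ 'n ^ 'n" where
  "lyapunov_op M S = M ** S + S ** transpose M"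

lemma matrix_vector_mult_minus_left:
  fixes A :: "real ^ 'n ^ 'm"
  shows "(- A) *v x = - (A *v x)"
  using matrix_vector_mult_diff_rdistrib[of 0 A x] by simp

lemma inner_matrix_vector_transpose:
  fixes A :: "real ^ 'n ^ 'm"
  shows "x \<bullet> (A *v y) = (transpose A *v x) \<bullet> y"
  by (simp add: dot_lmul_matrix)

lemma symmetric_inner_commute:
  fixes A :: "real ^ 'n ^ 'n"
  assumes "transpose A = A"
  shows "x \<bullet> (A *v y) = y \<bullet> (A *v x)"
  using inner_matrix_vector_transpose[of x A y] assms by (simp add: inner_commute)

text \<open>A zero of a nonnegative form is a minimum, and moving from \<open>x\<close> against
  \<open>Y *v x\<close> would push the form below zero.\<close>

lemma semidefinite_null_vector:
  fixes Y :: "real ^ 'n ^ 'n"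
  assumes sym: "transpose Y = Y" and nonneg: "\<And>y. y \<bullet> (Y *v y) \<ge> 0"
    and null: "x \<bullet> (Y *v x) = 0"
  shows "Y *v x = 0"
proof (rule ccontr)
  define w where "w = Y *v x"
  define c where "c = w \<bullet> (Y *v w)"
  \<comment> \<open>The step is short enough that the quadratic term \<open>s * c\<close> stays
    below the linear term \<open>2 * (w \<bullet> w)\<close>; the \<open>+ 1\<close> covers
    \<open>c = 0\<close>.\<close>
  define s where "s = (w \<bullet> w) / (c + 1)"
  assume "Y *v x \<noteq> 0"
  then have w: "w \<bullet> w > 0" by (simp add: w_def)
  have c: "c \<ge> 0" unfolding c_def by (rule nonneg)
  have s: "s > 0" using w c by (simp add: s_def)
  have "x \<bullet> (Y *v w) = w \<bullet> w"
    using symmetric_inner_commute[OF sym, of x w] by (simp add: w_def)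
  then have "(x - s *\<^sub>R w) \<bullet> (Y *v (x - s *\<^sub>R w)) = s * (s * c - 2 * (w \<bullet> w))"
    using null by (simp add: matrix_vector_mult_diff_distrib inner_diff_left inner_diff_right
        matrix_vector_mult_scaleR w_def[symmetric] c_def[symmetric] algebra_simps)
  with nonneg[of "x - s *\<^sub>R w"] s have "2 * (w \<bullet> w) \<le> s * c"
    by (simp add: zero_le_mult_iff)
  also have "s * c \<le> w \<bullet> w"
    using c w by (simp add: s_def field_simps)
  finally show False using w by simp
qed

lemma PD_D:
  assumes "A \<in> PD"
  shows "transpose A = A" and "x \<noteq> 0 \<Longrightarrow> x \<bullet> (A *v x) > 0"
  using assms by (auto simp: PD_def)

text \<open>Here \<open>l\<close> is the minimum of the Rayleigh quotient on the unit sphere and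
  \<open>x\<close> a minimizer: \<open>X - l P\<close> is positive semidefinite with null vector
  \<open>x\<close>.\<close>

lemma generalized_min_eigenvector:
  fixes X P :: "real ^ 'n ^ 'n"
  assumes sym: "transpose X = X" and P: "P \<in> PD"
  obtains l x where "x \<noteq> 0" "X *v x = l *\<^sub>R (P *v x)"
    "\<And>y. y \<bullet> (X *v y) \<ge> l * (y \<bullet> (P *v y))"
proof -
  define f where "f = (\<lambda>x. (x \<bullet> (X *v x)) / (x \<bullet> (P *v x)))"
  let ?S = "sphere (0 :: real ^ 'n) 1"
  have S: "compact ?S" "?S \<noteq> {}" by auto
  have pos: "x \<bullet> (P *v x) > 0" if "x \<noteq> 0" for x using PD_D(2)[OF P that] .
  have "x \<bullet> (P *v x) \<noteq> 0" if "x \<in> ?S" for x using pos[of x] that by fastforce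
  then have "continuous_on ?S f" unfolding f_def
    by (intro continuous_intros matrix_vector_mult_linear_continuous_on) auto
  then obtain x where x: "x \<in> ?S" "\<And>y. y \<in> ?S \<Longrightarrow> f x \<le> f y"
    using continuous_attains_inf[OF S] by blast
  define Y where "Y = X - f x *\<^sub>R P"
  have x0: "x \<noteq> 0" using x by auto
  have Yv: "Y *v y = X *v y - f x *\<^sub>R (P *v y)" for y
    by (simp add: Y_def matrix_vector_mult_diff_rdistrib scaleR_matrix_vector_assoc)
  have ge: "f x * (y \<bullet> (P *v y)) \<le> y \<bullet> (X *v y)" for y
  proof (cases "y = 0")
    case False
    have "f y = f (y /\<^sub>R norm y)" using False
      by (simp add: f_def matrix_vector_mult_scaleR)
    moreover have "f x \<le> f (y /\<^sub>R norm y)" using False by (intro x) simp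
    ultimately have "f x \<le> (y \<bullet> (X *v y)) / (y \<bullet> (P *v y))" by (simp add: f_def)
    then show ?thesis using pos[OF False] by (simp add: field_simps)
  qed simp
  have "Y *v x = 0"
  proof (rule semidefinite_null_vector)
    show "transpose Y = Y" using sym PD_D(1)[OF P]
      by (simp add: Y_def transpose_def vec_eq_iff)
    show "y \<bullet> (Y *v y) \<ge> 0" for y using ge by (simp add: Yv inner_diff_right)
    show "x \<bullet> (Y *v x) = 0" using pos[OF x0] by (simp add: Yv inner_diff_right f_def)
  qed
  then show thesis using that[OF x0 _ ge] by (simp add: Yv)
qed

text \<open>For symmetric \<open>S\<close> the two summands of the operator are transposes of each
  other and so have the same quadratic form.\<close>

lemma quadratic_lyapunov_op:
  fixes M S :: "real ^ 'n ^ 'n"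
  assumes "transpose S = S"
  shows "x \<bullet> (lyapunov_op M S *v x) = 2 * (x \<bullet> (M *v (S *v x)))"
proof -
  have "x \<bullet> (S *v (transpose M *v x)) = (S *v x) \<bullet> (transpose M *v x)"
    using inner_matrix_vector_transpose[of x S] assms by simp
  also have "\<dots> = x \<bullet> (M *v (S *v x))"
    using inner_matrix_vector_transpose[of x M "S *v x"] by (simp add: inner_commute)
  finally show ?thesis
    by (simp add: lyapunov_op_def matrix_vector_mult_add_rdistrib inner_add_right
        matrix_vector_mul_assoc[symmetric] del: transpose_matrix_vector)
qed

lemma linear_lyapunov_op: "linear (lyapunov_op M)" "linear (\<lambda>M. lyapunov_op M S)"
  by (rule linearI; simp add: lyapunov_op_def matrix_matrix_mult_def transpose_def vec_eq_iff
      sum.distrib sum_distrib_left algebra_simps)+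

section \<open>Uniqueness, positivity and stability from a Lyapunov certificate\<close>

text \<open>The matrix \<open>P\<close> certifies stability of \<open>M\<close> without reference to
  eigenvalues of \<open>M\<close>. As \<open>q\<close> is positive, the sign of the least
  generalized eigenvalue \<open>l\<close> can be read off from
  \<open>lyapunov_op M X\<close>.\<close>

lemma lyapunov_op_min_eigenvector:
  fixes M P X :: "real ^ 'n ^ 'n"
  assumes P: "P \<in> PD" and Q: "- lyapunov_op M P \<in> PD" and sym: "transpose X = X"
  obtains l x q where "x \<noteq> 0" "q > 0" "x \<bullet> (lyapunov_op M X *v x) = - l * q"
    "\<And>y. y \<bullet> (X *v y) \<ge> l * (y \<bullet> (P *v y))"
proof -
  obtain l x where x: "x \<noteq> 0" "X *v x = l *\<^sub>R (P *v x)"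
    "\<And>y. y \<bullet> (X *v y) \<ge> l * (y \<bullet> (P *v y))"
    by (rule generalized_min_eigenvector[OF sym P]) (rule that)
  have "x \<bullet> (lyapunov_op M X *v x) = l * (x \<bullet> (lyapunov_op M P *v x))"
    by (simp add: quadratic_lyapunov_op sym PD_D(1)[OF P] x(2) matrix_vector_mult_scaleR)
  moreover have "x \<bullet> ((- lyapunov_op M P) *v x) > 0" using PD_D(2)[OF Q x(1)] .
  ultimately show thesis using that[of x "- (x \<bullet> (lyapunov_op M P *v x))" l] x
    by (simp add: matrix_vector_mult_minus_left)
qed

text \<open>A positive definite right-hand side makes \<open>l\<close> positive, and the form of
  \<open>X\<close> dominates \<open>l\<close> times that of \<open>P\<close>.\<close>

lemma lyapunov_op_PD:
  assumes P: "P \<in> PD" and Q: "- lyapunov_op M P \<in> PD"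
    and sym: "transpose X = X" and C: "- lyapunov_op M X \<in> PD"
  shows "X \<in> PD"
proof -
  obtain l x q where x: "x \<noteq> 0" "q > 0" "x \<bullet> (lyapunov_op M X *v x) = - l * q"
    "\<And>y. y \<bullet> (X *v y) \<ge> l * (y \<bullet> (P *v y))"
    by (rule lyapunov_op_min_eigenvector[OF P Q sym]) (rule that)
  have "l * q > 0"
    using PD_D(2)[OF C x(1)] x(3) by (simp add: matrix_vector_mult_minus_left)
  then have "l > 0" using x(2) by (simp add: zero_less_mult_iff)
  then have "y \<bullet> (X *v y) > 0" if "y \<noteq> 0" for y
    using x(4)[of y] PD_D(2)[OF P that] by (smt (verit) mult_pos_pos)
  with sym show ?thesis by (simp add: PD_def)
qed

text \<open>A zero right-hand side forces \<open>l = 0\<close>, so \<open>X\<close> and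
  \<open>- X\<close> are both positive semidefinite. This yields uniqueness of symmetric
  solutions.\<close>

lemma lyapunov_op_eq_0:
  fixes M P X :: "real ^ 'n ^ 'n"
  assumes P: "P \<in> PD" and Q: "- lyapunov_op M P \<in> PD"
    and sym: "transpose X = X" and X: "lyapunov_op M X = 0"
  shows "X = 0"
proof -
  have nonneg: "y \<bullet> (Z *v y) \<ge> 0" if Z: "transpose Z = Z" "lyapunov_op M Z = 0" for y Z
  proof -
    obtain l x q where "x \<noteq> 0" "q > 0" "x \<bullet> (lyapunov_op M Z *v x) = - l * q"
      and ge: "\<And>y. y \<bullet> (Z *v y) \<ge> l * (y \<bullet> (P *v y))"
      by (rule lyapunov_op_min_eigenvector[OF P Q Z(1)]) (rule that)
    then have "l = 0" using Z(2) by simp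
    then show ?thesis using ge by simp
  qed
  have sym': "transpose (- X) = - X" using sym by (simp add: transpose_def vec_eq_iff)
  have op': "lyapunov_op M (- X) = 0" using linear_neg[OF linear_lyapunov_op(1), of M X] X by simp
  have zero: "y \<bullet> (X *v y) = 0" for y
    using nonneg[OF sym X, of y] nonneg[OF sym' op', of y] by (simp add: matrix_vector_mult_minus_left)
  have "X *v y = 0" for y
    by (rule semidefinite_null_vector[OF sym]) (simp_all add: zero)
  then show ?thesis by (simp add: matrix_eq)
qed

lemma PD_surj:
  fixes P :: "real ^ 'n ^ 'n"
  assumes "P \<in> PD"
  shows "surj ((*v) P)"
proof -
  have "x = 0" if "P *v x = 0" for x using PD_D(2)[OF assms, of x] that by force
  then have "inj ((*v) P)"
    by (simp add: linear_injective_0)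
  then show ?thesis by (simp add: linear_injective_imp_surjective)
qed

text \<open>One direction of Lyapunov's stability theorem, done over the reals by splitting a
  complex eigenvector into \<open>a\<close> and \<open>b\<close>.\<close>

lemma lyapunov_stable:
  fixes M P :: "real ^ 'n ^ 'n"
  assumes P: "P \<in> PD" and Q: "- lyapunov_op M P \<in> PD"
  shows "stable_matrix M"
  unfolding stable_matrix_def complex_eigenvalue_def
proof (intro allI impI, elim exE conjE)
  fix z v assume v: "v \<noteq> 0" and ev: "map_matrix complex_of_real M *v v = z *s v"
  define a where "a = (\<chi> i. Re (v $ i))"
  define b where "b = (\<chi> i. Im (v $ i))"
  have comp: "(\<Sum>j\<in>UNIV. complex_of_real (M $ i $ j) * v $ j) = z * v $ i" for i
    using arg_cong[OF ev, of "\<lambda>w. w $ i"] by (simp add: matrix_vector_mult_def map_matrix_def)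
  have Ma: "M *v a = Re z *\<^sub>R a - Im z *\<^sub>R b"
    using arg_cong[OF comp, of Re] by (simp add: vec_eq_iff a_def b_def matrix_vector_mult_def)
  have Mb: "M *v b = Im z *\<^sub>R a + Re z *\<^sub>R b"
    using arg_cong[OF comp, of Im]
    by (simp add: vec_eq_iff a_def b_def matrix_vector_mult_def algebra_simps)
  \<comment> \<open>Applying the inverse of \<open>P\<close> turns
    \<open>a' \<bullet> (M *v a)\<close> into the form of \<open>M P\<close> at \<open>a'\<close>,
    which \<open>Q\<close> makes negative; likewise for \<open>b\<close>.\<close>
  obtain a' b' where ab: "a = P *v a'" "b = P *v b'" using PD_surj[OF P] by (metis surjD)
  have sym: "transpose P = P" using PD_D(1)[OF P] .
  have neg: "x \<bullet> (M *v (P *v x)) < 0" if "x \<noteq> 0" for x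
    using PD_D(2)[OF Q that] quadratic_lyapunov_op[OF sym, of x M]
    by (simp add: matrix_vector_mult_minus_left)
  have neg0: "x \<bullet> (M *v (P *v x)) \<le> 0" for x using neg[of x] by (cases "x = 0") auto
  have pos0: "x \<bullet> (P *v x) \<ge> 0" for x using PD_D(2)[OF P, of x] by (cases "x = 0") auto
  have "a \<noteq> 0 \<or> b \<noteq> 0" using v by (auto simp: a_def b_def vec_eq_iff complex_eq_iff)
  then have ne: "a' \<noteq> 0 \<or> b' \<noteq> 0" using ab by auto
  \<comment> \<open>The terms with \<open>Im z\<close> cancel because \<open>P\<close> is
    symmetric.\<close>
  have "a' \<bullet> (M *v a) + b' \<bullet> (M *v b) = Re z * (a' \<bullet> (P *v a') + b' \<bullet> (P *v b'))"
    unfolding Ma Mb using symmetric_inner_commute[OF sym, of a' b']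
    by (simp add: ab inner_add_right inner_diff_right algebra_simps)
  moreover have "a' \<bullet> (M *v a) + b' \<bullet> (M *v b) < 0"
    using ne neg[of a'] neg[of b'] neg0[of a'] neg0[of b'] by (auto simp: ab)
  ultimately show "Re z < 0"
    using pos0[of a'] pos0[of b'] by (simp add: mult_less_0_iff)
qed

lemma lyapunov_map_eqI:
  assumes S: "S \<in> PD" and C: "C \<in> PD" and eq: "lyapunov_op M S = - C"
  shows "lyapunov_map C M = S"
  unfolding lyapunov_map_def
proof (rule the_equality)
  show "S \<in> PD \<and> M ** S + S ** transpose M + C = 0"
    using S eq by (simp add: lyapunov_op_def)
  fix T assume T: "T \<in> PD \<and> M ** T + T ** transpose M + C = 0"
  then have T_eq: "lyapunov_op M T = - C" by (simp add: lyapunov_op_def eq_neg_iff_add_eq_0)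
  have "T - S = 0"
  \<comment> \<open>The solution \<open>S\<close> itself is the certificate, since
    \<open>- lyapunov_op M S\<close> equals \<open>C\<close>.\<close>
  proof (rule lyapunov_op_eq_0[OF S])
    show "- lyapunov_op M S \<in> PD" using eq C by simp
    show "transpose (T - S) = T - S"
      using PD_D(1)[OF S] PD_D(1) T by (force simp: transpose_def vec_eq_iff)
    show "lyapunov_op M (T - S) = 0"
      using linear_diff[OF linear_lyapunov_op(1), of M T S] eq T_eq by simp
  qed
  then show "T = S" by simp
qed

section \<open>Treks and zero patterns\<close>

text \<open>Prolonging the left side at its far end leaves the top node unchanged.\<close>

lemma trek_between_extend:
  assumes "trek_between E k j" "(k, i) \<in> E"
  shows "trek_between E i j"
proof -
  obtain ls rs where t: "trek E ls rs" "last ls = k" "last rs = j"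
    using assms(1) by (auto simp: trek_between_def)
  have "trek E (ls @ [i]) rs"
    using t assms(2) by (auto simp: trek_def directed_walk_def successively_append_iff)
  then show ?thesis using t(3) unfolding trek_between_def by (metis last_snoc)
qed

lemma trek_between_sym: "trek_between E i j \<Longrightarrow> trek_between E j i"
  by (auto simp: trek_between_def trek_def) metis

lemma trek_between_refl: "trek_between E i i"
proof -
  have "trek E [i] [i]" by (simp add: trek_def directed_walk_def)
  then show ?thesis unfolding trek_between_def by force
qed

text \<open>A space preserved by \<open>lyapunov_op M\<close> for every \<open>M\<close> in
  \<open>edge_matrices E\<close>; its dimension is what \<open>card E\<close> is compared
  with.\<close>

definition trek_matrices :: "('n \<times> 'n) set \<Rightarrow> (real ^ 'n ^ 'n) set" where
  "trek_matrices E = {S. transpose S = S \<and> (\<forall>i j. \<not> trek_between E i j \<longrightarrow> S $ i $ j = 0)}"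

lemma subspace_trek_matrices: "subspace (trek_matrices E)"
  by (auto simp: subspace_def trek_matrices_def transpose_def vec_eq_iff)

text \<open>A nonzero term \<open>M $ i $ k * S $ k $ j\<close> needs an edge from \<open>k\<close>
  to \<open>i\<close> and a trek between \<open>k\<close> and \<open>j\<close>, hence a trek between
  \<open>i\<close> and \<open>j\<close>. The lemma serves both for fixed \<open>M\<close> and for
  fixed \<open>S\<close>.\<close>

lemma lyapunov_op_trek_matrices:
  assumes M: "M \<in> edge_matrices E" and S: "S \<in> trek_matrices E"
  shows "lyapunov_op M S \<in> trek_matrices E"
proof -
  have sym: "S $ i $ j = S $ j $ i" for i j
    using S by (auto simp: trek_matrices_def transpose_def vec_eq_iff)
  have "M $ i $ k * S $ k $ j = 0" if "\<not> trek_between E i j" for i j k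
    using M S that trek_between_extend[of E k j i]
    by (auto simp: edge_matrices_def trek_matrices_def)
  then have zero: "(\<Sum>k\<in>UNIV. M $ i $ k * S $ k $ j) = 0" if "\<not> trek_between E i j" for i j
    using that by (intro sum.neutral) blast
  have comp: "lyapunov_op M S $ i $ j
      = (\<Sum>k\<in>UNIV. M $ i $ k * S $ k $ j) + (\<Sum>k\<in>UNIV. M $ j $ k * S $ k $ i)" for i j
    by (simp add: lyapunov_op_def matrix_matrix_mult_def transpose_def sym[of i] mult.commute)
  show ?thesis
    using zero trek_between_sym[of E]
    by (force simp: trek_matrices_def vec_eq_iff transpose_def comp add.commute)
qed

lemma diagonal_trek_matrices:
  assumes "diagonal_matrix C"
  shows "C \<in> trek_matrices E"
  using assms trek_between_refl[of E]
  by (auto simp: diagonal_matrix_def trek_matrices_def transpose_def vec_eq_iff) metis+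

section \<open>Dimension counts\<close>

text \<open>The case \<open>i = j\<close> is included, so these are the subsets of size one and
  two.\<close>

lemma card_unordered_pairs:
  "card {{i, j} | i j :: 'n::finite. True} = CARD('n) * (CARD('n) + 1) div 2"
proof -
  have eq: "{{i, j} | i j :: 'n. True}
      = {A. A \<subseteq> UNIV \<and> card A = 1} \<union> {A. A \<subseteq> UNIV \<and> card A = 2}"
    by (auto simp: card_1_singleton_iff card_2_iff card_insert_if)
  have "card {{i, j} | i j :: 'n. True} = (CARD('n) choose 1) + (CARD('n) choose 2)"
    unfolding eq by (subst card_Un_disjoint; (simp only: n_subsets finite)?) auto
  also have "\<dots> = CARD('n) * (CARD('n) + 1) div 2"
    by (cases "CARD('n)") (simp_all add: choose_two)
  finally show ?thesis .
qed

text \<open>The symmetric 0-1 matrices \<open>B K\<close>, one for each unordered pair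
  \<open>K\<close> joined by a trek, span the space.\<close>

lemma dim_trek_matrices:
  fixes E :: "('n::finite \<times> 'n) set"
  shows "dim (trek_matrices E) + card (no_trek_pairs E) \<le> CARD('n) * (CARD('n) + 1) div 2"
proof -
  let ?U = "{{i, j} | i j :: 'n. True}"
  define T where "T = ?U - no_trek_pairs E"
  define B where "B = (\<lambda>K. (\<chi> i j. if {i, j} = K then 1 else 0) :: real ^ 'n ^ 'n)"
  have "trek_matrices E \<subseteq> span (B ` T)"
  proof
    fix S assume S: "S \<in> trek_matrices E"
    \<comment> \<open>The choice among the two orders of \<open>K\<close> is harmless, as
      \<open>S\<close> is symmetric.\<close>
    define c where "c = (\<lambda>K. SOME x. \<exists>i j. K = {i, j} \<and> x = S $ i $ j)"
    have sym: "S $ i $ j = S $ j $ i" for i j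
      using S by (auto simp: trek_matrices_def transpose_def vec_eq_iff)
    have c: "c {i, j} = S $ i $ j" for i j
      unfolding c_def by (rule some_equality) (auto simp: doubleton_eq_iff sym)
    have "(\<Sum>K\<in>T. c K *\<^sub>R B K) $ i $ j = S $ i $ j" for i j
    proof -
      have "(\<Sum>K\<in>T. c K *\<^sub>R B K) $ i $ j = (\<Sum>K\<in>T. if K = {i, j} then c K else 0)"
        unfolding sum_component vector_scaleR_component real_scaleR_def
        by (intro sum.cong) (auto simp: B_def)
      also have "\<dots> = (if {i, j} \<in> T then S $ i $ j else 0)" by (simp add: c)
      \<comment> \<open>For a pair outside \<open>T\<close> a trek is missing in one of the two
        orders; \<open>sym\<close> carries the zero entry to the other.\<close>
      also have "\<dots> = S $ i $ j"
        using S sym[of i j]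
        by (auto simp: T_def no_trek_pairs_def trek_matrices_def doubleton_eq_iff)
      finally show ?thesis .
    qed
    then have "S = (\<Sum>K\<in>T. c K *\<^sub>R B K)" by (simp add: vec_eq_iff)
    also have "\<dots> \<in> span (B ` T)"
      by (intro span_sum span_scale span_base imageI)
    finally show "S \<in> span (B ` T)" .
  qed
  then have "dim (trek_matrices E) \<le> card (B ` T)" by (intro dim_le_card) auto
  also have "\<dots> \<le> card T" by (rule card_image_le) simp
  also have "card T = card ?U - card (no_trek_pairs E)"
    unfolding T_def by (rule card_Diff_subset) (auto simp: no_trek_pairs_def)
  finally have "dim (trek_matrices E) \<le> card ?U - card (no_trek_pairs E)" .
  moreover have "card (no_trek_pairs E) \<le> card ?U"
    by (rule card_mono) (auto simp: no_trek_pairs_def)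
  ultimately show ?thesis unfolding card_unordered_pairs by linarith
qed

lemma subspace_edge_matrices: "subspace (edge_matrices E)"
  by (auto simp: subspace_def edge_matrices_def)

lemma card_le_dim_edge_matrices:
  fixes E :: "('n::finite \<times> 'n) set"
  shows "card E \<le> dim (edge_matrices E)"
proof -
  define B where "B = (\<lambda>(i, j). axis j (axis i 1) :: real ^ 'n ^ 'n)"
  have "inj_on B E" by (auto simp: inj_on_def B_def axis_eq_axis)
  then have "card E = card (B ` E)" by (simp add: card_image)
  also have "\<dots> \<le> dim (edge_matrices E)"
  proof (rule independent_card_le_dim)
    show "B ` E \<subseteq> edge_matrices E" by (auto simp: B_def edge_matrices_def axis_def)
    have "B ` E \<subseteq> Basis" by (auto simp: B_def Basis_vec_def)
    then show "independent (B ` E)" using independent_Basis independent_mono by blast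
  qed
  finally show ?thesis .
qed

lemma linear_subspace_kernel:
  fixes f :: "'a::euclidean_space \<Rightarrow> 'b::euclidean_space"
  assumes f: "linear f" and V: "subspace V" and img: "f ` V \<subseteq> W" and dim: "dim W < dim V"
  obtains x where "x \<in> V" "x \<noteq> 0" "f x = 0"
proof -
  have "\<exists>x\<in>V. x \<noteq> 0 \<and> f x = 0"
  proof (rule ccontr)
    assume "\<not> ?thesis"
    then have "inj_on f V" using linear_inj_on_iff_eq_0[OF f V] by blast
    then have "inj_on f (span V)" using V by (simp add: span_eq_iff[THEN iffD2])
    then have "dim (f ` V) = dim V" by (rule dim_image_eq[OF f])
    moreover have "dim (f ` V) \<le> dim W" using img by (rule dim_subset)
    ultimately show False using dim by simp
  qed
  then show thesis using that by blast
qed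

section \<open>Solutions with the trek zeros and nontrivial fibers\<close>

text \<open>The operator is injective on \<open>trek_matrices E\<close> and maps this
  finite-dimensional space into itself, so it is onto. Existence and zero pattern of the solution
  come together.\<close>

lemma lyapunov_solution_trek_matrices:
  assumes M: "M \<in> edge_matrices E" and P: "P \<in> PD" and Q: "- lyapunov_op M P \<in> PD"
    and C: "C \<in> PD" "diagonal_matrix C"
  obtains S where "S \<in> PD" "S \<in> trek_matrices E" "lyapunov_op M S = - C"
proof -
  let ?W = "trek_matrices E" and ?f = "lyapunov_op M"
  have sub: "subspace ?W" by (rule subspace_trek_matrices)
  have lin: "linear ?f" by (rule linear_lyapunov_op)
  have sym: "transpose S = S" if "S \<in> ?W" for S using that by (simp add: trek_matrices_def)
  have "inj_on ?f ?W"
    using linear_inj_on_iff_eq_0[OF lin sub] lyapunov_op_eq_0[OF P Q] sym by blast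
  then have "dim (?f ` ?W) = dim ?W"
    using dim_image_eq[OF lin] sub by (simp add: span_eq_iff[THEN iffD2])
  moreover have "?f ` ?W \<subseteq> ?W" using lyapunov_op_trek_matrices[OF M] by blast
  ultimately have "?f ` ?W = ?W"
    using subspace_dim_equal[of "?f ` ?W" ?W] linear_subspace_image[OF lin sub] sub by simp
  moreover have "- C \<in> ?W" using subspace_neg[OF sub diagonal_trek_matrices[OF C(2)]] .
  ultimately obtain S where S: "S \<in> ?W" "?f S = - C" by (metis imageE)
  moreover have "S \<in> PD" using lyapunov_op_PD[OF P Q sym[OF S(1)]] S(2) C(1) by simp
  ultimately show thesis using that by blast
qed

lemma lyapunov_fiber_nontrivial:
  assumes M: "M \<in> edge_matrices E" and P: "P \<in> PD" and Q: "- lyapunov_op M P \<in> PD"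
    and C: "C \<in> PD" "diagonal_matrix C" and dim: "dim (trek_matrices E) < dim (edge_matrices E)"
  shows "lyapunov_fiber E C M \<noteq> {M}"
proof -
  obtain S where S: "S \<in> PD" "S \<in> trek_matrices E" "lyapunov_op M S = - C"
    using lyapunov_solution_trek_matrices[OF M P Q C] by blast
  \<comment> \<open>Now \<open>S\<close> is fixed and the coefficient matrix varies:
    \<open>edge_matrices E\<close> is mapped linearly into a space of smaller dimension.\<close>
  obtain D where D: "D \<in> edge_matrices E" "D \<noteq> 0" "lyapunov_op D S = 0"
    using linear_subspace_kernel[OF linear_lyapunov_op(2) subspace_edge_matrices _ dim]
      lyapunov_op_trek_matrices[OF _ S(2)] by (metis image_subsetI)
  have eq: "lyapunov_op (M + D) S = - C"
    by (simp add: linear_add[OF linear_lyapunov_op(2)] S(3) D(3))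
  \<comment> \<open>The certificate for \<open>M + D\<close> is \<open>S\<close>, no longer
    \<open>P\<close>.\<close>
  have "M + D \<in> Stab E"
    using subspace_add[OF subspace_edge_matrices M D(1)] lyapunov_stable[OF S(1), of "M + D"] eq C(1)
    by (simp add: Stab_def)
  moreover have "lyapunov_map C (M + D) = lyapunov_map C M"
    using lyapunov_map_eqI[OF S(1) C(1)] eq S(3) by simp
  ultimately have "M + D \<in> lyapunov_fiber E C M" by (simp add: lyapunov_fiber_def)
  then show ?thesis using D(2) by auto
qed

section \<open>A box of positive measure near \<open>- mat 1\<close>\<close>

lemma mat_1_PD: "mat 1 \<in> (PD :: (real ^ 'n ^ 'n) set)"
  by (simp add: PD_def)

text \<open>The diagonal contributes at most \<open>- (x \<bullet> x)\<close> to
  \<open>x \<bullet> (M *v x)\<close>. The error terms in \<open>bound\<close> add up to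
  \<open>(x \<bullet> x) / 2\<close>, so at most \<open>- (x \<bullet> x) / 2\<close>
  remains.\<close>

lemma diagonally_dominant_lyapunov_op:
  fixes M :: "real ^ 'n ^ 'n"
  assumes diag: "\<And>i. M $ i $ i \<le> - 1"
    and off: "\<And>i j. i \<noteq> j \<Longrightarrow> \<bar>M $ i $ j\<bar> \<le> 1 / (2 * real CARD('n))"
  shows "- lyapunov_op M (mat 1) \<in> PD"
proof -
  let ?p = "real CARD('n)"
  have sym: "transpose (- lyapunov_op M (mat 1)) = - lyapunov_op M (mat 1)"
    by (simp add: lyapunov_op_def transpose_def vec_eq_iff)
  have "x \<bullet> (M *v x) < 0" if "x \<noteq> 0" for x
  proof -
    have p: "?p > 0" by simp
    \<comment> \<open>The error term is granted on the diagonal too, which makes the double sum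
      uniform in \<open>i\<close> and \<open>j\<close>.\<close>
    have bound: "x $ i * (M $ i $ j * x $ j)
        \<le> (if i = j then - (x $ i)\<^sup>2 else 0) + ((x $ i)\<^sup>2 + (x $ j)\<^sup>2) / (4 * ?p)" for i j
    proof (cases "i = j")
      case True
      have "M $ i $ i * (x $ i)\<^sup>2 \<le> - 1 * (x $ i)\<^sup>2" by (intro mult_right_mono diag) simp
      then have "x $ i * (M $ i $ j * x $ j) \<le> - (x $ i)\<^sup>2"
        using True by (simp add: power2_eq_square mult.left_commute mult.commute)
      moreover have "((x $ i)\<^sup>2 + (x $ j)\<^sup>2) / (4 * ?p) \<ge> 0" by simp
      ultimately have "x $ i * (M $ i $ j * x $ j)
          \<le> - (x $ i)\<^sup>2 + ((x $ i)\<^sup>2 + (x $ j)\<^sup>2) / (4 * ?p)" by linarith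
      then show ?thesis using True by (simp only: if_True simp_thms)
    next
      case False
      have "x $ i * (M $ i $ j * x $ j) \<le> \<bar>M $ i $ j\<bar> * \<bar>x $ i * x $ j\<bar>"
        by (metis abs_ge_self abs_mult mult.left_commute)
      also have "\<dots> \<le> 1 / (2 * ?p) * (((x $ i)\<^sup>2 + (x $ j)\<^sup>2) / 2)"
      proof (intro mult_mono off False)
        have "2 * \<bar>x $ i\<bar> * \<bar>x $ j\<bar> \<le> (x $ i)\<^sup>2 + (x $ j)\<^sup>2"
          using sum_squares_bound[of "\<bar>x $ i\<bar>" "\<bar>x $ j\<bar>"] by simp
        then show "\<bar>x $ i * x $ j\<bar> \<le> ((x $ i)\<^sup>2 + (x $ j)\<^sup>2) / 2" by (simp add: abs_mult)
      qed simp_all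
      finally show ?thesis using False by simp
    qed
    have nn: "x \<bullet> x = (\<Sum>i\<in>UNIV. (x $ i)\<^sup>2)" by (simp add: inner_vec_def power2_eq_square)
    have "x \<bullet> (M *v x) = (\<Sum>i\<in>UNIV. \<Sum>j\<in>UNIV. x $ i * (M $ i $ j * x $ j))"
      by (simp add: inner_vec_def matrix_vector_mult_def sum_distrib_left)
    also have "\<dots> \<le> (\<Sum>i\<in>UNIV. \<Sum>j\<in>UNIV. (if i = j then - (x $ i)\<^sup>2 else 0)
        + ((x $ i)\<^sup>2 + (x $ j)\<^sup>2) / (4 * ?p))"
      by (intro sum_mono bound)
    also have "\<dots> = (\<Sum>i\<in>UNIV. - 3 / 4 * (x $ i)\<^sup>2 + (x \<bullet> x) / (4 * ?p))"
    proof (rule sum.cong[OF refl])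
      fix i
      have "(\<Sum>j\<in>UNIV. (if i = j then - (x $ i)\<^sup>2 else 0) + ((x $ i)\<^sup>2 + (x $ j)\<^sup>2) / (4 * ?p))
          = - (x $ i)\<^sup>2 + (?p * (x $ i)\<^sup>2 + x \<bullet> x) / (4 * ?p)"
        by (simp add: sum.distrib sum_divide_distrib[symmetric] nn)
      also have "\<dots> = - 3 / 4 * (x $ i)\<^sup>2 + (x \<bullet> x) / (4 * ?p)"
        using p by (simp add: field_simps)
      finally show "(\<Sum>j\<in>UNIV. (if i = j then - (x $ i)\<^sup>2 else 0) + ((x $ i)\<^sup>2 + (x $ j)\<^sup>2) / (4 * ?p))
          = - 3 / 4 * (x $ i)\<^sup>2 + (x \<bullet> x) / (4 * ?p)" .
    qed
    also have "\<dots> = - 3 / 4 * (x \<bullet> x) + ?p * ((x \<bullet> x) / (4 * ?p))"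
      unfolding sum.distrib sum_distrib_left[symmetric] nn[symmetric] by simp
    also have "\<dots> = - (x \<bullet> x) / 2" using p by (simp add: field_simps)
    also have "\<dots> < 0" using that by simp
    finally show ?thesis .
  qed
  with sym show ?thesis
    by (simp add: PD_def quadratic_lyapunov_op matrix_vector_mult_minus_left)
qed

text \<open>In edge coordinates \<open>X\<close> contains a product of nondegenerate intervals,
  whose measure is the product of their lengths.\<close>

lemma diagonally_dominant_not_null:
  fixes E :: "('n::finite \<times> 'n) set"
  assumes X: "\<And>M. M \<in> edge_matrices E \<Longrightarrow> - lyapunov_op M (mat 1) \<in> PD \<Longrightarrow> M \<in> X"
    and self_loops: "\<And>i. (i, i) \<in> E"
  shows "\<not> lebesgue_null_in_edge_matrices E X"
proof
  interpret product_sigma_finite "\<lambda>_ :: 'n \<times> 'n. lborel :: real measure"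
    by standard
  define e where "e = 1 / (2 * real CARD('n))"
  define I :: "'n \<times> 'n \<Rightarrow> real set"
    \<comment> \<open>The ends \<open>- 1\<close> and \<open>e\<close> are the bounds of
      \<open>diagonally_dominant_lyapunov_op\<close>; \<open>- 2\<close> is arbitrary and only gives
      the interval positive length.\<close>
    where "I = (\<lambda>(i, j). if i = j then {- 2..- 1} else {- e..e})"
  define B where "B = PiE E I"
  let ?N = "PiM E (\<lambda>_. lborel :: real measure)"
  have e: "e > 0" by (simp add: e_def)
  have fin: "finite E" by simp
  have meas: "I ij \<in> sets lborel" for ij by (cases ij) (simp add: I_def)
  have B_sets: "B \<in> sets ?N" unfolding B_def using meas by (intro sets_PiM_I_finite fin) auto
  have "emeasure ?N B = (\<Prod>ij\<in>E. emeasure lborel (I ij))"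
    unfolding B_def using fin meas by (rule emeasure_PiM)
  moreover have "emeasure lborel (I ij) \<noteq> 0" for ij
    using e by (cases ij) (auto simp: I_def)
  ultimately have pos: "emeasure ?N B \<noteq> 0" using fin by simp
  have "B \<subseteq> edge_coords E ` X"
  proof
    fix f assume f: "f \<in> B"
    \<comment> \<open>The preimage of \<open>f\<close> under the coordinate map, with zeros off
      \<open>E\<close>.\<close>
    define M :: "real ^ 'n ^ 'n" where "M = (\<chi> j i. if (i, j) \<in> E then f (i, j) else 0)"
    have M: "M \<in> edge_matrices E" by (simp add: M_def edge_matrices_def)
    have fI: "f ij \<in> I ij" if "ij \<in> E" for ij using f that by (auto simp: B_def)
    have "- lyapunov_op M (mat 1) \<in> PD"
    proof (rule diagonally_dominant_lyapunov_op)
      \<comment> \<open>Self-loops make every diagonal entry a free coordinate; without the loop it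
        would be zero.\<close>
      show "M $ i $ i \<le> - 1" for i
        using fI[OF self_loops[of i]] self_loops by (simp add: M_def I_def)
      show "\<bar>M $ i $ j\<bar> \<le> 1 / (2 * real CARD('n))" if "i \<noteq> j" for i j
        using fI[of "(j, i)"] that e by (auto simp: M_def I_def e_def[symmetric])
    qed
    with M have "M \<in> X" by (rule X)
    moreover have "edge_coords E M = f"
      using f by (auto simp: edge_coords_def M_def B_def fun_eq_iff restrict_def PiE_def extensional_def)
    ultimately show "f \<in> edge_coords E ` X" by blast
  qed
  moreover assume "lebesgue_null_in_edge_matrices E X"
  \<comment> \<open>Completeness passes nullity on to the subset \<open>B\<close>; as
    \<open>B\<close> is measurable for \<open>?N\<close>, its measure there is the same.\<close>
  ultimately have "B \<in> null_sets (completion ?N)"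
    unfolding lebesgue_null_in_edge_matrices_def by (meson null_sets_completion_subset)
  then have "emeasure ?N B = 0" using B_sets by (auto simp: null_sets_def)
  with pos show False by contradiction
qed

theorem corollary38:
  fixes E :: "('n::finite \<times> 'n) set"
    and C :: "real ^ 'n ^ 'n"
  assumes self_loops: "\<And>i. (i, i) \<in> E"
    and C_PD: "C \<in> PD"
    and C_diagonal: "diagonal_matrix C"
    and identifiable: "generically_identifiable E C"
  shows "real (card E) \<le> real (CARD('n) * (CARD('n) + 1)) / 2 - real (card (no_trek_pairs E))"
proof -
  have "card E \<le> dim (trek_matrices E)"
  proof (rule ccontr)
    assume "\<not> ?thesis"
    then have dim: "dim (trek_matrices E) < dim (edge_matrices E)"
      using card_le_dim_edge_matrices[of E] by linarith
    have "M \<in> {M0 \<in> Stab E. lyapunov_fiber E C M0 \<noteq> {M0}}"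
      if "M \<in> edge_matrices E" "- lyapunov_op M (mat 1) \<in> PD" for M
      using that lyapunov_fiber_nontrivial[OF that(1) mat_1_PD that(2) C_PD C_diagonal dim]
        lyapunov_stable[OF mat_1_PD that(2)] by (simp add: Stab_def)
    then show False
      using diagonally_dominant_not_null self_loops identifiable
      unfolding generically_identifiable_def by blast
  qed
  then have "card E + card (no_trek_pairs E) \<le> CARD('n) * (CARD('n) + 1) div 2"
    using dim_trek_matrices[of E] by linarith
  \<comment> \<open>Rounding in \<open>div\<close> is harmless: a natural number is at most
    \<open>n div 2\<close> exactly if its double is at most \<open>n\<close>.\<close>
  then have "2 * (card E + card (no_trek_pairs E)) \<le> CARD('n) * (CARD('n) + 1)"
    by (subst mult.commute) (simp add: less_eq_div_iff_mult_less_eq)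
  then have "2 * (real (card E) + real (card (no_trek_pairs E))) \<le> real (CARD('n) * (CARD('n) + 1))"
    by (metis (mono_tags) of_nat_add of_nat_le_iff of_nat_mult of_nat_numeral)
  then show ?thesis by (simp add: field_simps del: of_nat_add of_nat_mult)
qed

end
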